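(* Let $k_1,k_2,k_3\in\mathbb{Z}_{\geq 0}$ and consider the Diophantine equation \[x^2+y^2+z^2+k_1xy+k_2yz+k_3zx=(3+k_1+k_2+k_3)xyz. \qquad (\ast)\] Every positive integer solution $(x,y,z)$ of $(\ast)$ appears exactly once as a vertex of the tree $\mathbb{T}^{k_1,k_2,k_3}$ (defined in the context).
   Context: The tree $\mathbb{T}^{k_1,k_2,k_3}$ has triplets of positive integers as vertices and is built as follows. (1) The root vertex is $(1,1,1)$. (2) The root $(1,1,1)$ has exactly three children: $(k_2+2,1,1)$, $(1,k_3+2,1)$, $(1,1,k_1+2)$. (3) Every vertex $(a,b,c)$ other than the root has exactly two children, determined as follows: (i) if $a$ is the maximal number in $(a,b,c)$, the children are $\left(a,\frac{a^2+k_3ac+c^2}{b},c\right)$ and $\left(a,b,\frac{a^2+k_1ab+b^2}{c}\right)$; (ii) if $b$ is the maximal number in $(a,b,c)$, the children are $\left(\frac{b^2+k_2bc+c^2}{a},b,c\right)$ and $\left(a,b,\frac{a^2+k_1ab+b^2}{c}\right)$; (iii) if $c$ is the maximal number in $(a,b,c)$, the children are $\left(\frac{b^2+k_2bc+c^2}{a},b,c\right)$ and $\left(a,\frac{a^2+k_3ac+c^2}{b},c\right)$. *)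

theory Defs
  imports Complex_Main
begin

text \<open>
  Labels are triples over \<open>rat\<close>, so that \<open>/\<close> in the child formulas is exact division
  rather than truncating integer division.
\<close>

type_synonym triple = "rat \<times> rat \<times> rat"

definition root_children :: "nat \<Rightarrow> nat \<Rightarrow> nat \<Rightarrow> triple list" where
  "root_children k1 k2 k3 =
     [(of_nat k2 + 2, 1, 1), (1, of_nat k3 + 2, 1), (1, 1, of_nat k1 + 2)]"

text \<open>
  The order of the three tests matters only if the maximal entry is not unique,
  which happens at no vertex of the tree other than the root.
\<close>

fun nonroot_children :: "nat \<Rightarrow> nat \<Rightarrow> nat \<Rightarrow> triple \<Rightarrow> triple list" where
  "nonroot_children k1 k2 k3 (a, b, c) =
    (let a' = (b\<^sup>2 + of_nat k2 * b * c + c\<^sup>2) / a;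
         b' = (a\<^sup>2 + of_nat k3 * a * c + c\<^sup>2) / b;
         c' = (a\<^sup>2 + of_nat k1 * a * b + b\<^sup>2) / c
     in if b \<le> a \<and> c \<le> a then [(a, b', c), (a, b, c')]
        else if a \<le> b \<and> c \<le> b then [(a', b, c), (a, b, c')]
        else [(a', b, c), (a, b', c)])"

text \<open>
  \<open>vertex_at k1 k2 k3 p v\<close>: the tree has a vertex at position \<open>p\<close>, and it is labelled \<open>v\<close>.
  A position is the list of child indices along the path from the root, last step first, so
  the root is \<open>[]\<close>. Equal triples at different positions are different occurrences, and the root
  is recognised by its position, not by its label.
\<close>

inductive vertex_at :: "nat \<Rightarrow> nat \<Rightarrow> nat \<Rightarrow> nat list \<Rightarrow> triple \<Rightarrow> bool"
  for k1 k2 k3 where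
  root: "vertex_at k1 k2 k3 [] (1, 1, 1)"
| root_child:
    "i < length (root_children k1 k2 k3) \<Longrightarrow>
     vertex_at k1 k2 k3 [i] (root_children k1 k2 k3 ! i)"
| child:
    "vertex_at k1 k2 k3 p v \<Longrightarrow> p \<noteq> [] \<Longrightarrow> i < length (nonroot_children k1 k2 k3 v) \<Longrightarrow>
     vertex_at k1 k2 k3 (i # p) (nonroot_children k1 k2 k3 v ! i)"

end

theory Submission
  imports Defs
begin

text \<open>
  For fixed \<open>b, c\<close> the equation is quadratic in the first entry, so each solution \<open>(a, b, c)\<close> has a
  neighbour \<open>(a', b, c)\<close>, where \<open>a + a'\<close> and \<open>a a' = b\<^sup>2 + k\<^sub>2 b c + c\<^sup>2\<close> are given by Vieta, and
  likewise for the other entries. Unless \<open>b = c = 1\<close>, the quadratic is negative at \<open>max b c\<close>, which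
  therefore lies strictly between \<open>a\<close> and \<open>a'\<close>. Hence every solution other than \<open>(1, 1, 1)\<close> has a
  strict maximum; flipping the maximal entry decreases the sum of the entries, while flipping
  another entry makes that entry the new strict maximum. So the parent of a vertex is obtained by
  flipping its maximal entry, which gives uniqueness, and descent along these flips ends in
  \<open>(1, 1, 1)\<close>, which gives existence.
\<close>

section \<open>Vieta conjugation in one entry\<close>

definition sol :: "nat \<Rightarrow> nat \<Rightarrow> nat \<Rightarrow> int \<Rightarrow> int \<Rightarrow> int \<Rightarrow> bool" where
  "sol k1 k2 k3 a b c \<longleftrightarrow> a > 0 \<and> b > 0 \<and> c > 0 \<and>
     a\<^sup>2 + b\<^sup>2 + c\<^sup>2 + int k1 * a * b + int k2 * b * c + int k3 * c * a
       = (3 + int k1 + int k2 + int k3) * a * b * c"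

text \<open>The second root of the quadratic in the first entry, taken from the sum of the roots so
  that it is visibly an integer.\<close>

definition conj_root :: "nat \<Rightarrow> nat \<Rightarrow> nat \<Rightarrow> int \<Rightarrow> int \<Rightarrow> int \<Rightarrow> int" where
  "conj_root k1 k2 k3 a b c =
     (3 + int k1 + int k2 + int k3) * b * c - int k1 * b - int k3 * c - a"

text \<open>Lets facts about the first entry serve for the other two.\<close>

lemma sol_rotate: "sol k1 k2 k3 a b c \<longleftrightarrow> sol k2 k3 k1 b c a"
  unfolding sol_def by (auto simp: algebra_simps)

lemma conj_root_mult:
  assumes "sol k1 k2 k3 a b c"
  shows "a * conj_root k1 k2 k3 a b c = b\<^sup>2 + int k2 * b * c + c\<^sup>2"
  using assms unfolding sol_def conj_root_def by (simp add: algebra_simps power2_eq_square)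

lemma conj_root_conj_root: "conj_root k1 k2 k3 (conj_root k1 k2 k3 a b c) b c = a"
  by (simp add: conj_root_def)

lemma sol_conj_root:
  assumes "sol k1 k2 k3 a b c"
  shows "sol k1 k2 k3 (conj_root k1 k2 k3 a b c) b c"
proof -
  let ?a' = "conj_root k1 k2 k3 a b c"
  have pos: "a > 0" "b > 0" "c > 0"
    using assms by (auto simp: sol_def)
  have "b\<^sup>2 > 0" "int k2 * b * c \<ge> 0" "c\<^sup>2 > 0"
    using pos by auto
  then have "a * ?a' > 0"
    using conj_root_mult[OF assms] by linarith
  then have a': "?a' > 0"
    using pos by (simp add: zero_less_mult_iff)
  have "a = (3 + int k1 + int k2 + int k3) * b * c - int k1 * b - int k3 * c - ?a'"
    by (simp add: conj_root_def)
  then have "?a' * ((3 + int k1 + int k2 + int k3) * b * c - int k1 * b - int k3 * c - ?a')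
      = b\<^sup>2 + int k2 * b * c + c\<^sup>2"
    using conj_root_mult[OF assms] by (simp add: mult.commute)
  then show ?thesis
    using a' pos unfolding sol_def by (simp add: algebra_simps power2_eq_square)
qed

text \<open>Here \<open>m\<close> and \<open>n\<close> are the larger and smaller of
  \<open>b\<close>, \<open>c\<close>, and left minus right is the quadratic at \<open>m\<close>.
  Each left-hand term is compared with a copy of \<open>m\<^sup>2 * n\<close>; only
  \<open>n\<^sup>2\<close> gives strictness, through \<open>n < m\<^sup>2\<close>.\<close>

lemma quadratic_neg_at_max:
  fixes m n p q :: int
  assumes "1 \<le> n" "n \<le> m" "1 < m" "0 \<le> p" "0 \<le> q"
  shows "2 * m\<^sup>2 + n\<^sup>2 + p * m\<^sup>2 + q * (m * n) < (3 + p + q) * (m\<^sup>2 * n)"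
proof -
  have 1: "m\<^sup>2 \<le> m\<^sup>2 * n"
    using assms by (simp add: mult_le_cancel_left1)
  have "m < m * m"
    using assms by simp
  then have "n < m\<^sup>2"
    using assms(2) unfolding power2_eq_square by linarith
  then have 2: "n\<^sup>2 < m\<^sup>2 * n"
    using assms by (simp add: power2_eq_square)
  have "m \<le> m\<^sup>2"
    using assms by (simp add: power2_eq_square)
  then have 3: "m * n \<le> m\<^sup>2 * n"
    using assms by (intro mult_right_mono) auto
  have "p * m\<^sup>2 \<le> p * (m\<^sup>2 * n)" "q * (m * n) \<le> q * (m\<^sup>2 * n)"
    using 1 3 assms by (auto intro: mult_left_mono)
  then show ?thesis
    using 1 2 by (simp add: algebra_simps)
qed

lemma max_between_roots:
  assumes sol: "sol k1 k2 k3 a b c" and "\<not> (b = 1 \<and> c = 1)"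
  shows "(a < max b c \<and> max b c < conj_root k1 k2 k3 a b c) \<or>
         (conj_root k1 k2 k3 a b c < max b c \<and> max b c < a)"
proof -
  let ?a' = "conj_root k1 k2 k3 a b c"
  have pos: "b \<ge> 1" "c \<ge> 1"
    using sol by (auto simp: sol_def)
  have sum: "a + ?a' = (3 + int k1 + int k2 + int k3) * b * c - int k1 * b - int k3 * c"
    by (simp add: conj_root_def)
  have expand: "(a - m) * (?a' - m) = a * ?a' - m * (a + ?a') + m\<^sup>2" for m
    by (simp add: algebra_simps power2_eq_square)
  \<comment> \<open>The left side is the quadratic evaluated at \<open>max b c\<close>, by
    Vieta.\<close>
  have "(a - max b c) * (?a' - max b c) < 0"
  proof (cases "c \<le> b")
    case True
    then have "2 * b\<^sup>2 + c\<^sup>2 + int k1 * b\<^sup>2 + int (k2 + k3) * (b * c)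
        < (3 + int k1 + int (k2 + k3)) * (b\<^sup>2 * c)"
      using pos assms(2) by (intro quadratic_neg_at_max) auto
    then show ?thesis
      using True unfolding expand sum conj_root_mult[OF sol]
      by (simp add: max_def algebra_simps power2_eq_square)
  next
    case False
    then have "2 * c\<^sup>2 + b\<^sup>2 + int k3 * c\<^sup>2 + int (k1 + k2) * (c * b)
        < (3 + int k3 + int (k1 + k2)) * (c\<^sup>2 * b)"
      using pos by (intro quadratic_neg_at_max) auto
    then show ?thesis
      using False unfolding expand sum conj_root_mult[OF sol]
      by (simp add: max_def algebra_simps power2_eq_square)
  qed
  then show ?thesis
    by (auto simp: mult_less_0_iff)
qed

text \<open>Covers the case excluded from \<open>max_between_roots\<close>: for
  \<open>b = c = 1\<close> the quadratic vanishes at 1.\<close>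

lemma sol_ones:
  assumes "sol k1 k2 k3 a 1 1"
  shows "a = 1 \<or> conj_root k1 k2 k3 a 1 1 = 1"
proof -
  let ?a' = "conj_root k1 k2 k3 a 1 1"
  have "(a - 1) * (?a' - 1) = a * ?a' - (a + ?a') + 1"
    by (simp add: algebra_simps)
  also have "\<dots> = 0"
    unfolding conj_root_mult[OF assms] by (simp add: conj_root_def)
  finally show ?thesis
    by auto
qed

section \<open>Flips and strict maxima of triples\<close>

type_synonym itriple = "int \<times> int \<times> int"

fun sol3 :: "nat \<Rightarrow> nat \<Rightarrow> nat \<Rightarrow> itriple \<Rightarrow> bool" where
  "sol3 k1 k2 k3 (a, b, c) = sol k1 k2 k3 a b c"

fun flip :: "nat \<Rightarrow> nat \<Rightarrow> nat \<Rightarrow> nat \<Rightarrow> itriple \<Rightarrow> itriple" where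
  "flip k1 k2 k3 j (a, b, c) =
     (if j = 0 then (conj_root k1 k2 k3 a b c, b, c)
      else if j = 1 then (a, conj_root k2 k3 k1 b c a, c)
      else (a, b, conj_root k3 k1 k2 c a b))"

fun dominant :: "nat \<Rightarrow> itriple \<Rightarrow> bool" where
  "dominant j (a, b, c) \<longleftrightarrow>
     j = 0 \<and> b < a \<and> c < a \<or> j = 1 \<and> a < b \<and> c < b \<or> j = 2 \<and> a < c \<and> b < c"

fun total :: "itriple \<Rightarrow> nat" where
  "total (a, b, c) = nat (a + b + c)"

fun of_itriple :: "itriple \<Rightarrow> triple" where
  "of_itriple (a, b, c) = (of_int a, of_int b, of_int c)"

text \<open>The increasing order matches the order in which \<open>nonroot_children\<close> lists
  the children.\<close>

definition other_indices :: "nat \<Rightarrow> nat list" where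
  "other_indices i = filter (\<lambda>j. j \<noteq> i) [0, 1, 2]"

lemma other_indices_set: "set (other_indices i) = {j. j < 3 \<and> j \<noteq> i}"
  by (auto simp: other_indices_def)

lemma distinct_other_indices: "distinct (other_indices i)"
  by (simp add: other_indices_def)

lemma length_other_indices: "i < 3 \<Longrightarrow> length (other_indices i) = 2"
  by (auto simp: other_indices_def)

lemma of_itriple_eq_iff [simp]: "of_itriple u = of_itriple v \<longleftrightarrow> u = v"
  by (cases u; cases v) auto

lemma dominant_less_3: "dominant j v \<Longrightarrow> j < 3"
  by (cases v) auto

lemma dominant_unique: "dominant i v \<Longrightarrow> dominant j v \<Longrightarrow> i = j"
  by (cases v) auto

lemma not_dominant_ones [simp]: "\<not> dominant j (1, 1, 1)"
  by simp

lemma sol3_flip: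
  assumes "sol3 k1 k2 k3 v"
  shows "sol3 k1 k2 k3 (flip k1 k2 k3 j v)"
proof -
  obtain a b c where v: "v = (a, b, c)"
    by (cases v)
  have "sol k1 k2 k3 a b c" "sol k2 k3 k1 b c a" "sol k3 k1 k2 c a b"
    using assms sol_rotate[of k1 k2 k3 a b c] sol_rotate[of k2 k3 k1 b c a]
    unfolding v by simp_all
  then have "sol k1 k2 k3 (conj_root k1 k2 k3 a b c) b c"
      "sol k2 k3 k1 (conj_root k2 k3 k1 b c a) c a"
      "sol k3 k1 k2 (conj_root k3 k1 k2 c a b) a b"
    by (simp_all add: sol_conj_root)
  then show ?thesis
    unfolding v using sol_rotate[of k1 k2 k3] sol_rotate[of k2 k3 k1] by simp
qed

lemma flip_flip [simp]: "flip k1 k2 k3 j (flip k1 k2 k3 j v) = v"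
  by (cases v) (auto simp: conj_root_conj_root)

lemma max_between_roots_cyclic:
  assumes "sol3 k1 k2 k3 (a, b, c)"
  shows "\<not> (b = 1 \<and> c = 1) \<Longrightarrow>
           (a < max b c \<and> max b c < conj_root k1 k2 k3 a b c) \<or>
           (conj_root k1 k2 k3 a b c < max b c \<and> max b c < a)"
    and "\<not> (c = 1 \<and> a = 1) \<Longrightarrow>
           (b < max c a \<and> max c a < conj_root k2 k3 k1 b c a) \<or>
           (conj_root k2 k3 k1 b c a < max c a \<and> max c a < b)"
    and "\<not> (a = 1 \<and> b = 1) \<Longrightarrow>
           (c < max a b \<and> max a b < conj_root k3 k1 k2 c a b) \<or>
           (conj_root k3 k1 k2 c a b < max a b \<and> max a b < c)"
  using assms max_between_roots[of k1 k2 k3 a b c] max_between_roots[of k2 k3 k1 b c a]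
    max_between_roots[of k3 k1 k2 c a b] sol_rotate[of k1 k2 k3 a b c] sol_rotate[of k2 k3 k1 b c a]
  by auto

lemma sol3_pos: "sol3 k1 k2 k3 (a, b, c) \<Longrightarrow> 0 < a \<and> 0 < b \<and> 0 < c"
  by (simp add: sol_def)

text \<open>If two entries share the maximum, either one equals the maximum of the remaining two,
  contradicting strict betweenness unless all entries are 1.\<close>

lemma sol3_dominant:
  assumes "sol3 k1 k2 k3 v" "v \<noteq> (1, 1, 1)"
  shows "\<exists>j. dominant j v"
proof -
  obtain a b c where v: "v = (a, b, c)"
    by (cases v)
  have "b < a \<and> c < a \<or> a < b \<and> c < b \<or> a < c \<and> b < c"
    using max_between_roots_cyclic[of k1 k2 k3 a b c] sol3_pos[of k1 k2 k3 a b c] assms unfolding v by (smt (verit))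
  then show ?thesis
    unfolding v by auto
qed

text \<open>Entry \<open>i\<close> is the maximum of the two entries kept and exceeds 1, so it
  separates entry \<open>j\<close> from its conjugate; as entry \<open>j\<close> lies below, the
  conjugate lies above.\<close>

lemma dominant_flip:
  assumes "sol3 k1 k2 k3 v" "dominant i v" "j \<noteq> i" "j < 3"
  shows "dominant j (flip k1 k2 k3 j v)"
proof -
  obtain a b c where v: "v = (a, b, c)"
    by (cases v)
  have "j = 0 \<or> j = 1 \<or> j = 2"
    using assms(4) by auto
  then show ?thesis
    using max_between_roots_cyclic[of k1 k2 k3 a b c] sol3_pos[of k1 k2 k3 a b c] assms unfolding v
    by (elim disjE) (auto simp: max_def split: if_splits)
qed

text \<open>Equality occurs for \<open>b = c = 1\<close>, where the conjugate is 1.\<close>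

lemma conj_root_le_max:
  assumes "sol k1 k2 k3 a b c" "b < a" "c < a"
  shows "conj_root k1 k2 k3 a b c \<le> max b c"
  using max_between_roots[OF assms(1)] sol_ones[of k1 k2 k3 a] assms by fastforce

lemma flip_dominant:
  assumes "sol3 k1 k2 k3 v" "dominant j v"
  shows "\<not> dominant j (flip k1 k2 k3 j v)" "total (flip k1 k2 k3 j v) < total v"
proof -
  obtain a b c where v: "v = (a, b, c)"
    by (cases v)
  have s: "sol k1 k2 k3 a b c" "sol k2 k3 k1 b c a" "sol k3 k1 k2 c a b"
    using assms(1) sol_rotate[of k1 k2 k3 a b c] sol_rotate[of k2 k3 k1 b c a]
    unfolding v by simp_all
  have "0 < a" "0 < b" "0 < c"
    using s(1) by (auto simp: sol_def)
  then show "\<not> dominant j (flip k1 k2 k3 j v)" "total (flip k1 k2 k3 j v) < total v"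
    using assms(2) conj_root_le_max[OF s(1)] conj_root_le_max[OF s(2)] conj_root_le_max[OF s(3)]
    unfolding v by (auto simp: max_def split: if_splits)
qed

section \<open>Children in the tree as flips\<close>

lemma root_children_eq_flip:
  "root_children k1 k2 k3 = map (\<lambda>j. of_itriple (flip k1 k2 k3 j (1, 1, 1))) [0, 1, 2]"
  by (simp add: root_children_def conj_root_def)

text \<open>The product of the roots yields the quotient used in the tree, so that division is
  exact.\<close>

lemma of_int_conj_root:
  assumes "sol k1 k2 k3 a b c"
  shows "rat_of_int (conj_root k1 k2 k3 a b c)
    = ((of_int b)\<^sup>2 + of_nat k2 * of_int b * of_int c + (of_int c)\<^sup>2) / of_int a"
proof -
  have "rat_of_int (a * conj_root k1 k2 k3 a b c) = of_int (b\<^sup>2 + int k2 * b * c + c\<^sup>2)"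
    by (simp only: conj_root_mult[OF assms])
  moreover have "rat_of_int a \<noteq> 0"
    using assms by (simp add: sol_def)
  ultimately show ?thesis
    by (simp add: field_simps)
qed

lemma nonroot_children_eq_flip:
  assumes "sol3 k1 k2 k3 v" "dominant i v"
  shows "nonroot_children k1 k2 k3 (of_itriple v)
    = map (\<lambda>j. of_itriple (flip k1 k2 k3 j v)) (other_indices i)"
proof -
  obtain a b c where v: "v = (a, b, c)"
    by (cases v)
  have s: "sol k1 k2 k3 a b c" "sol k2 k3 k1 b c a" "sol k3 k1 k2 c a b"
    using assms(1) sol_rotate[of k1 k2 k3 a b c] sol_rotate[of k2 k3 k1 b c a]
    unfolding v by simp_all
  show ?thesis
    using assms(2) unfolding v
    by (auto simp: other_indices_def s[THEN of_int_conj_root] Let_def algebra_simps)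
qed

text \<open>An inversion rule: the dominant entry \<open>j\<close> of a label tells which flip leads
  back to its parent. The child index \<open>n\<close> is \<open>j\<close> itself below the root,
  and elsewhere the place of \<open>j\<close> among the indices not dominant in the parent.\<close>

lemma vertex_at_cases:
  assumes "vertex_at k1 k2 k3 p q"
  shows "p = [] \<and> q = of_itriple (1, 1, 1) \<or>
    (\<exists>v j n p'. p = n # p' \<and> q = of_itriple v \<and> sol3 k1 k2 k3 v \<and> dominant j v \<and>
       vertex_at k1 k2 k3 p' (of_itriple (flip k1 k2 k3 j v)) \<and>
       (p' = [] \<longrightarrow> n = j) \<and>
       (p' \<noteq> [] \<longrightarrow> (\<exists>i. dominant i (flip k1 k2 k3 j v) \<and> n < 2 \<and>
          j = other_indices i ! n)))"
  using assms
proof induction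
  case root
  show ?case by simp
next
  case (root_child n)
  let ?v = "flip k1 k2 k3 n (1, 1, 1)"
  have n: "n = 0 \<or> n = 1 \<or> n = 2"
    using root_child by (auto simp: root_children_def)
  have "root_children k1 k2 k3 ! n = of_itriple ?v"
    using n by (auto simp: root_children_eq_flip)
  moreover have "sol3 k1 k2 k3 ?v"
    by (intro sol3_flip) (simp add: sol_def)
  moreover have "dominant n ?v"
    using n by (auto simp: conj_root_def)
  moreover have "vertex_at k1 k2 k3 [] (of_itriple (flip k1 k2 k3 n ?v))"
    unfolding flip_flip using vertex_at.root by simp
  ultimately show ?case
    by blast
next
  case (child p u n)
  then obtain v i where v: "u = of_itriple v" "sol3 k1 k2 k3 v" "dominant i v"
    by blast
  have ch: "nonroot_children k1 k2 k3 u
      = map (\<lambda>j. of_itriple (flip k1 k2 k3 j v)) (other_indices i)"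
    using nonroot_children_eq_flip[OF v(2,3)] v(1) by simp
  have n: "n < length (other_indices i)" "n < 2"
    using child ch length_other_indices[OF dominant_less_3[OF v(3)]] by auto
  define j w where "j = other_indices i ! n" and "w = flip k1 k2 k3 j v"
  have "j \<noteq> i" "j < 3"
    using nth_mem[OF n(1)] by (auto simp: j_def other_indices_set)
  then have "dominant j w"
    using dominant_flip v unfolding w_def by blast
  moreover have "nonroot_children k1 k2 k3 u ! n = of_itriple w"
    using n by (simp add: ch j_def w_def)
  moreover have "sol3 k1 k2 k3 w"
    using v(2) by (simp add: w_def sol3_flip)
  moreover have "flip k1 k2 k3 j w = v"
    by (simp add: w_def)
  ultimately show ?case
    using v n(2) child(1,2) j_def by blast
qed

section \<open>Uniqueness and existence of the position\<close>

lemma vertex_at_unique: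
  "vertex_at k1 k2 k3 p q \<Longrightarrow> vertex_at k1 k2 k3 p' q \<Longrightarrow> p = p'"
proof (induction p arbitrary: p' q)
  case Nil
  then show ?case
    using vertex_at_cases[OF Nil(1)] vertex_at_cases[OF Nil(2)]
    by (auto simp del: of_itriple.simps)
next
  case (Cons n p)
  obtain v j where v: "q = of_itriple v" "dominant j v"
      "vertex_at k1 k2 k3 p (of_itriple (flip k1 k2 k3 j v))" "p = [] \<longrightarrow> n = j"
      "p \<noteq> [] \<longrightarrow> (\<exists>i. dominant i (flip k1 k2 k3 j v) \<and> n < 2 \<and>
          j = other_indices i ! n)"
    using vertex_at_cases[OF Cons.prems(1)] by blast
  \<comment> \<open>This rules out \<open>p' = []\<close>.\<close>
  have "v \<noteq> (1, 1, 1)"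
    using v(2) not_dominant_ones by blast
  then obtain w j' n' r where w: "p' = n' # r" "q = of_itriple w" "dominant j' w"
      "vertex_at k1 k2 k3 r (of_itriple (flip k1 k2 k3 j' w))" "r = [] \<longrightarrow> n' = j'"
      "r \<noteq> [] \<longrightarrow> (\<exists>i. dominant i (flip k1 k2 k3 j' w) \<and> n' < 2 \<and>
          j' = other_indices i ! n')"
    using vertex_at_cases[OF Cons.prems(2)] v(1) of_itriple_eq_iff by metis
  \<comment> \<open>The label fixes its dominant index, hence the label of the parent; induction
    then fixes the parent's position.\<close>
  have "w = v" "j' = j"
    using v w dominant_unique by auto
  with w v Cons.IH have "r = p"
    by blast
  \<comment> \<open>Away from the root, \<open>n\<close> and \<open>n'\<close> both locate
    \<open>j\<close> in the same list without repetitions.\<close>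
  moreover have "n' = n"
  proof (cases "p = []")
    case True
    then show ?thesis
      using v w \<open>r = p\<close> \<open>j' = j\<close> by simp
  next
    case False
    then obtain i where "dominant i (flip k1 k2 k3 j v)" "n < 2" "n' < 2"
        "other_indices i ! n = j" "other_indices i ! n' = j"
      using v w \<open>r = p\<close> \<open>w = v\<close> \<open>j' = j\<close> dominant_unique by metis
    moreover from this have "length (other_indices i) = 2"
      using dominant_less_3 length_other_indices by blast
    ultimately show ?thesis
      using nth_eq_iff_index_eq[OF distinct_other_indices] by metis
  qed
  ultimately show ?case
    using w by simp
qed

lemma sol3_vertex_at:
  "sol3 k1 k2 k3 v \<Longrightarrow> \<exists>p. vertex_at k1 k2 k3 p (of_itriple v)"
proof (induction "total v" arbitrary: v rule: less_induct)
  case less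
  show ?case
  proof (cases "v = (1, 1, 1)")
    case True
    then show ?thesis
      using vertex_at.root by auto
  next
    case False
    then obtain j where j: "dominant j v"
      using sol3_dominant less.prems by blast
    define u where "u = flip k1 k2 k3 j v"
    have vu: "v = flip k1 k2 k3 j u"
      by (simp add: u_def)
    show ?thesis
    \<comment> \<open>The triple \<open>u\<close> is the prospective parent; the root has no
      dominant entry and has its own rule for children.\<close>
    proof (cases "u = (1, 1, 1)")
      case True
      have "j < length (root_children k1 k2 k3)"
        using dominant_less_3[OF j] by (simp add: root_children_def)
      moreover have "root_children k1 k2 k3 ! j = of_itriple v"
        using dominant_less_3[OF j] unfolding root_children_eq_flip vu True
        by (auto simp: less_Suc_eq numeral_3_eq_3 numeral_2_eq_2 simp del: flip.simps)
      ultimately show ?thesis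
        using vertex_at.root_child by metis
    next
      case False
      have u: "sol3 k1 k2 k3 u"
        using less.prems by (simp add: u_def sol3_flip)
      obtain i where i: "dominant i u"
        using False sol3_dominant u by blast
      \<comment> \<open>Entry \<open>j\<close> lost its dominance in passing to \<open>u\<close>, so
        flipping it back is one of the moves the tree allows at \<open>u\<close>.\<close>
      have "i \<noteq> j"
        using flip_dominant(1)[OF less.prems j] i by (auto simp: u_def)
      then have "j \<in> set (other_indices i)"
        using dominant_less_3[OF j] by (simp add: other_indices_set)
      then have "of_itriple v \<in> set (nonroot_children k1 k2 k3 (of_itriple u))"
        unfolding nonroot_children_eq_flip[OF u i] vu by simp
      then obtain n where n: "n < length (nonroot_children k1 k2 k3 (of_itriple u))"
          "nonroot_children k1 k2 k3 (of_itriple u) ! n = of_itriple v"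
        by (meson in_set_conv_nth)
      obtain p where p: "vertex_at k1 k2 k3 p (of_itriple u)"
        using less.hyps flip_dominant(2)[OF less.prems j] u u_def by blast
      \<comment> \<open>The rule \<open>child\<close> requires a position other than the root, whose
        only label is \<open>(1, 1, 1)\<close>.\<close>
      moreover have "p \<noteq> []"
        using vertex_at_cases[OF p] False of_itriple_eq_iff by blast
      ultimately show ?thesis
        using vertex_at.child n by metis
    qed
  qed
qed

theorem theorem1p1:
  fixes k1 k2 k3 x y z :: nat
  assumes "x > 0" and "y > 0" and "z > 0"
    and "x\<^sup>2 + y\<^sup>2 + z\<^sup>2 + k1 * x * y + k2 * y * z + k3 * z * x
         = (3 + k1 + k2 + k3) * x * y * z"
  shows "\<exists>!p. vertex_at k1 k2 k3 p (of_nat x, of_nat y, of_nat z)"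
proof -
  have "int (x\<^sup>2 + y\<^sup>2 + z\<^sup>2 + k1 * x * y + k2 * y * z + k3 * z * x)
      = int ((3 + k1 + k2 + k3) * x * y * z)"
    by (simp only: assms(4))
  then have "sol3 k1 k2 k3 (int x, int y, int z)"
    using assms(1-3) by (simp add: sol_def)
  then show ?thesis
    using sol3_vertex_at[of k1 k2 k3 "(int x, int y, int z)"] vertex_at_unique by auto
qed

end
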